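(* Let $N\geq 5$. The Kirchhoff index of $C_N^2$ is \[ \mathrm{Kf}(C_N^2)=\frac{N(N-1)(5N+17)}{300}+\frac{2N^2}{25}\frac{F_{N-1}}{F_N}. \]
   Context: $C_N^2$ is the graph with vertex set $\mathbb{Z}_N$ in which $u,v$ are adjacent iff $u-v\in\{\pm1,\pm2\}$ mod $N$. For a connected graph $G$, the effective resistance $r(G;p,q)$ is the electrical resistance between $p$ and $q$ when each edge of $G$ is a unit resistor, and the Kirchhoff index is $\mathrm{Kf}(G)=\sum_{\{p,q\},\,p\neq q} r(G;p,q)$, the sum over unordered pairs of distinct vertices. $F_i$ is the $i$-th Fibonacci number ($F_0=0,F_1=1$). *)

theory Defs
  imports Complex_Main "Graph_Theory.Pair_Digraph" "HOL-Number_Theory.Fib"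
    "HOL-Number_Theory.Cong"
begin

text \<open>
  Finite simple graphs are represented as in the AFP entry Graph_Theory by symmetric loop-free
  pair digraphs (locale \<^locale>\<open>pair_graph\<close>): an undirected edge is a pair of
  opposite arcs.
\<close>

text \<open>
  Potentials realising a unit current that enters the network at \<open>p\<close> and leaves it at
  \<open>q\<close>, when every edge is a unit resistor.  By Ohm's law the current through the edge
  from \<open>u\<close> to \<open>w\<close> is \<open>\<phi> u - \<phi> w\<close>; the condition is Kirchhoff's current law
  at every vertex.
\<close>

definition unit_current_potential ::
    "'a pair_pre_digraph \<Rightarrow> 'a \<Rightarrow> 'a \<Rightarrow> ('a \<Rightarrow> real) \<Rightarrow> bool" where
  "unit_current_potential G p q \<phi> \<longleftrightarrow>
     (\<forall>u\<in>pverts G. (\<Sum>w | (u, w) \<in> parcs G. \<phi> u - \<phi> w) = of_bool (u = p) - of_bool (u = q))"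

text \<open>
  The resistance is the voltage between \<open>p\<close> and \<open>q\<close> divided by the (unit) current.  It does not
  depend on the choice of the potential, see \<open>effective_resistance_eqI\<close> below.
\<close>

definition effective_resistance :: "'a pair_pre_digraph \<Rightarrow> 'a \<Rightarrow> 'a \<Rightarrow> real" where
  "effective_resistance G p q =
     (THE r. \<exists>\<phi>. unit_current_potential G p q \<phi> \<and> r = \<phi> p - \<phi> q)"

text \<open>
  Each unordered pair of distinct vertices is counted once, through its increasing enumeration;
  the order is irrelevant by \<open>effective_resistance_commute\<close>.
\<close>

definition kirchhoff_index :: "'a::linorder pair_pre_digraph \<Rightarrow> real" where
  "kirchhoff_index G =
     (\<Sum>(p, q) \<in> {(p, q). p \<in> pverts G \<and> q \<in> pverts G \<and> p < q}. effective_resistance G p q)"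

text \<open>
  The graph $C_N^2$, with the residue classes modulo \<open>N\<close> represented by \<open>0, \<dots>, N - 1\<close>.
\<close>

definition cycle_square :: "nat \<Rightarrow> int pair_pre_digraph" where
  "cycle_square N =
     \<lparr> pverts = {0..<int N},
       parcs = {(u, v). u \<in> {0..<int N} \<and> v \<in> {0..<int N} \<and>
                  (\<exists>d\<in>{1, -1, 2, -2}. [u - v = d] (mod int N))} \<rparr>"

lemma effective_resistance_commute:
  "effective_resistance G p q = effective_resistance G q p"
proof -
  have flip: "unit_current_potential G y x (\<lambda>u. - \<phi> u)"
    if "unit_current_potential G x y \<phi>" for x y \<phi>
  proof -
    have "(\<Sum>w | (u, w) \<in> parcs G. - \<phi> u - - \<phi> w) = - (\<Sum>w | (u, w) \<in> parcs G. \<phi> u - \<phi> w)" for u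
      by (simp add: sum_negf [symmetric])
    with that show ?thesis
      by (simp add: unit_current_potential_def)
  qed
  have "\<exists>\<phi>. unit_current_potential G y x \<phi> \<and> r = \<phi> y - \<phi> x"
    if "\<exists>\<phi>. unit_current_potential G x y \<phi> \<and> r = \<phi> x - \<phi> y" for x y r
  proof -
    from that obtain \<phi> where "unit_current_potential G x y \<phi>" "r = \<phi> x - \<phi> y" by blast
    then show ?thesis
      by (intro exI [of _ "\<lambda>u. - \<phi> u"]) (simp add: flip)
  qed
  then have "(\<lambda>r. \<exists>\<phi>. unit_current_potential G p q \<phi> \<and> r = \<phi> p - \<phi> q) =
      (\<lambda>r. \<exists>\<phi>. unit_current_potential G q p \<phi> \<and> r = \<phi> q - \<phi> p)"
    by (intro ext) blast
  then show ?thesis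
    by (simp add: effective_resistance_def)
qed

lemma (in pair_graph) effective_resistance_eqI:
  assumes "p \<in> pverts G" "q \<in> pverts G" and \<phi>: "unit_current_potential G p q \<phi>"
  shows "effective_resistance G p q = \<phi> p - \<phi> q"
proof -
  let ?V = "pverts G" and ?A = "parcs G"
  have fin: "finite ?V" by simp
  have inV: "u \<in> ?V \<and> w \<in> ?V" if "(u, w) \<in> ?A" for u w
    using that in_arcsD1 in_arcsD2 by auto
  have symA: "(w, u) \<in> ?A" if "(u, w) \<in> ?A" for u w
    using that arcs_symmetric by blast
  have test: "(\<Sum>u\<in>?V. f u * (\<Sum>w | (u, w) \<in> ?A. g u - g w)) = f p - f q"
    if "unit_current_potential G p q g" for f g
  proof -
    have "(\<Sum>u\<in>?V. f u * (\<Sum>w | (u, w) \<in> ?A. g u - g w)) =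
        (\<Sum>u\<in>?V. f u * (of_bool (u = p) - of_bool (u = q)))"
      using that by (intro sum.cong) (auto simp: unit_current_potential_def)
    also have "\<dots> = (\<Sum>u\<in>?V. if u = p then f u else 0) - (\<Sum>u\<in>?V. if u = q then f u else 0)"
      unfolding sum_subtractf [symmetric] by (intro sum.cong) auto
    finally show ?thesis
      using assms fin by simp
  qed
  have green: "(\<Sum>u\<in>?V. f u * (\<Sum>w | (u, w) \<in> ?A. g u - g w)) =
      (\<Sum>u\<in>?V. \<Sum>w\<in>?V. if (u, w) \<in> ?A then f u * g u - f u * g w else 0)" for f g :: "'a \<Rightarrow> real"
  proof (intro sum.cong refl)
    fix u
    have "{w. (u, w) \<in> ?A} = {w \<in> ?V. (u, w) \<in> ?A}" using inV by blast
    then show "f u * (\<Sum>w | (u, w) \<in> ?A. g u - g w) =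
        (\<Sum>w\<in>?V. if (u, w) \<in> ?A then f u * g u - f u * g w else 0)"
      by (auto simp: sum_distrib_left right_diff_distrib sum.inter_filter [OF fin] intro!: sum.cong)
  qed
  have "\<psi> p - \<psi> q = \<phi> p - \<phi> q" if \<psi>: "unit_current_potential G p q \<psi>" for \<psi>
  proof -
    let ?S = "\<lambda>f g. \<Sum>u\<in>?V. \<Sum>w\<in>?V. if (u, w) \<in> ?A then f u * g w else (0 :: real)"
    let ?D = "\<Sum>u\<in>?V. \<Sum>w\<in>?V. if (u, w) \<in> ?A then \<psi> u * \<phi> u else 0"
    have split: "(\<Sum>u\<in>?V. \<Sum>w\<in>?V. if (u, w) \<in> ?A then f u * g u - f u * g w else 0) =
        (\<Sum>u\<in>?V. \<Sum>w\<in>?V. if (u, w) \<in> ?A then f u * g u else 0) - ?S f g" for f g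
      unfolding sum_subtractf [symmetric] by (intro sum.cong) auto
    have comm: "(\<Sum>u\<in>?V. \<Sum>w\<in>?V. if (u, w) \<in> ?A then \<phi> u * \<psi> u else 0) = ?D"
      by (simp only: mult.commute)
    have "?S \<phi> \<psi> = ?S \<psi> \<phi>"
      by (subst sum.swap, intro sum.cong refl) (use symA in \<open>auto simp: mult.commute\<close>)
    moreover have "\<psi> p - \<psi> q = ?D - ?S \<psi> \<phi>"
      using test [OF \<phi>, of \<psi>] unfolding green split by simp
    moreover have "\<phi> p - \<phi> q = ?D - ?S \<phi> \<psi>"
      using test [OF \<psi>, of \<phi>] unfolding green split comm by (rule sym)
    ultimately show ?thesis by simp
  qed
  with \<phi> show ?thesis
    unfolding effective_resistance_def by (intro the_equality) blast+
qed

lemma pair_graph_cycle_square: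
  assumes "N \<ge> 5"
  shows "pair_graph (cycle_square N)"
proof
  show "finite (pverts (cycle_square N))" by (simp add: cycle_square_def)
  have "parcs (cycle_square N) \<subseteq> {0..<int N} \<times> {0..<int N}"
    by (auto simp: cycle_square_def)
  then show "finite (parcs (cycle_square N))"
    by (rule finite_subset) simp
  show "fst e \<in> pverts (cycle_square N)" "snd e \<in> pverts (cycle_square N)"
    if "e \<in> parcs (cycle_square N)" for e
    using that by (auto simp: cycle_square_def)
  show "fst e \<noteq> snd e" if "e \<in> parcs (cycle_square N)" for e
  proof
    assume "fst e = snd e"
    moreover obtain u w where e: "e = (u, w)" by (cases e)
    ultimately have "\<exists>d\<in>{1, -1, 2, -2}. [u - u = d] (mod int N)"
      using that unfolding cycle_square_def by simp
    then obtain d where d: "d \<in> {1, -1, 2, -2}" "[0 = d] (mod int N)"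
      unfolding diff_self by blast
    have "int N dvd d"
      using d(2) by (simp add: cong_sym_eq [of 0] cong_0_iff)
    moreover have "d \<noteq> 0" "\<bar>d\<bar> \<le> 2" using d(1) by auto
    ultimately show False
      using dvd_imp_le_int [of d "int N"] assms by simp
  qed
  have "(v, u) \<in> parcs (cycle_square N)" if uv: "(u, v) \<in> parcs (cycle_square N)" for u v
  proof -
    from uv have "\<exists>d\<in>{1, -1, 2, -2}. [u - v = d] (mod int N)"
      unfolding cycle_square_def pair_pre_digraph.simps mem_Collect_eq prod.case by blast
    then obtain d where d: "d \<in> {1, -1, 2, -2}" "[u - v = d] (mod int N)"
      by blast
    then have "[v - u = - d] (mod int N)"
      using cong_minus_minus_iff [of "u - v" d "int N"] by simp
    moreover have "- d \<in> {1, -1, 2, -2}" using d(1) by auto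
    ultimately have "\<exists>d\<in>{1, -1, 2, -2}. [v - u = d] (mod int N)" by blast
    with uv show ?thesis
      unfolding cycle_square_def pair_pre_digraph.simps mem_Collect_eq prod.case by blast
  qed
  then show "symmetric (with_proj (cycle_square N))"
    by (auto simp: symmetric_def intro: symI)
qed

end

theory Submission
  imports Defs
begin

text \<open>
  Seek an even kernel \<open>h\<close> on the residues modulo \<open>N\<close> with \<open>h 0 = 0\<close> whose
  graph Laplacian is \<open>1 / N\<close> minus the point mass at \<open>0\<close>; then
  \<open>\<lambda>u. h (u - q) - h (u - p)\<close> is a unit current potential and the resistance between
  \<open>p\<close> and \<open>q\<close> is \<open>2 * h (q - p)\<close>.  Away from \<open>0\<close> the Laplacian has characteristic
  polynomial \<open>(2 - y) * (3 + y)\<close> in \<open>y = x + 1 / x\<close>.  The double root \<open>x = 1\<close> accounts for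
  the term \<open>k * (N - k)\<close> and the other roots, which are the ratios of the two roots of
  \<open>t^2 = t + 1\<close>, for the term \<open>fib k * fib (N - k)\<close>.  Summing \<open>h\<close> over all residues
  reduces the Kirchhoff index to the convolution of the Fibonacci sequence with itself.
\<close>

section \<open>The kernel and its graph Laplacian\<close>

definition resistance_kernel :: "nat \<Rightarrow> int \<Rightarrow> real" where
  "resistance_kernel N k =
     (let j = nat (k mod int N) in
      real j * (real N - real j) / (10 * real N)
        + real (fib j) * real (fib (N - j)) / (5 * real (fib N)))"

lemma resistance_kernel_cong:
  "[k = l] (mod int N) \<Longrightarrow> resistance_kernel N k = resistance_kernel N l"
  by (simp add: resistance_kernel_def cong_def)

lemma resistance_kernel_of_nat:
  assumes "j \<le> N"
  shows "resistance_kernel N (int j) =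
    real j * (real N - real j) / (10 * real N)
      + real (fib j) * real (fib (N - j)) / (5 * real (fib N))"
proof (cases "j = N")
  case False
  with assms have "nat (int j mod int N) = j" by simp
  then show ?thesis by (simp add: resistance_kernel_def)
qed (simp add: resistance_kernel_def)

lemma resistance_kernel_0 [simp]: "resistance_kernel N 0 = 0"
  by (simp add: resistance_kernel_def)

text \<open>The closed form is symmetric under exchanging \<open>j\<close> and
  \<open>N - j\<close>.\<close>

lemma resistance_kernel_minus:
  assumes "N > 0"
  shows "resistance_kernel N (- k) = resistance_kernel N k"
proof -
  define j where "j = nat (k mod int N)"
  have j: "int j = k mod int N" "j \<le> N"
    using assms by (simp_all add: j_def nat_le_iff order_less_imp_le)
  have "[k = int j] (mod int N)"
    by (simp add: j cong_def)
  moreover from this have "[- k = int (N - j)] (mod int N)"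
    using j by (simp add: cong_def of_nat_diff mod_simps)
  ultimately have "resistance_kernel N k = resistance_kernel N (int j)"
      "resistance_kernel N (- k) = resistance_kernel N (int (N - j))"
    by (simp_all add: resistance_kernel_cong)
  then show ?thesis
    using j(2) resistance_kernel_of_nat [of j N] resistance_kernel_of_nat [of "N - j" N]
    by (simp add: of_nat_diff mult.commute)
qed

text \<open>Residues 0 and 1, where the stencil crosses 0, are computed explicitly;
  \<open>N - 1\<close> follows by evenness, the rest from the closed form.\<close>

lemma resistance_kernel_laplacian:
  assumes "N \<ge> 3"
  shows "(\<Sum>d\<in>{1, -1, 2, -2}. resistance_kernel N k - resistance_kernel N (k + d)) =
    1 / real N - of_bool ([k = 0] (mod int N))"
proof -
  let ?H = "resistance_kernel N"
  let ?L = "\<lambda>k. 4 * ?H k - ?H (k + 1) - ?H (k - 1) - ?H (k + 2) - ?H (k - 2)"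
  have sum4: "(\<Sum>d\<in>{1, -1, 2, -2}. ?H k - ?H (k + d)) = ?L k" for k
    by simp
  have fibN: "real (fib N) > 0"
    using assms by (simp add: fib_neq_0_nat)
  have even: "?H (- k) = ?H k" for k
    using assms by (intro resistance_kernel_minus) simp
  have even_L: "?L (- k) = ?L k" for k
  proof -
    have "- k + 1 = - (k - 1)" "- k - 1 = - (k + 1)" "- k + 2 = - (k - 2)" "- k - 2 = - (k + 2)"
      by simp_all
    then show ?thesis by (simp only: even)
  qed
  obtain n where N: "N = n + 3"
    using assms by (metis add.commute le_Suc_ex)
  \<comment> \<open>The Fibonacci ratios in \<open>?H 1\<close>, \<open>?H 2\<close>,
    \<open>?H 3\<close> are all affine in \<open>t\<close>, which then cancels from
    \<open>?L 0\<close> and \<open>?L 1\<close>.\<close>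
  define t where "t = real (fib n) / real (fib N)"
  have "real (fib N) = real (fib n) + 2 * real (fib (n + 1))"
    by (simp add: N numeral_eq_Suc)
  then have t: "real (fib (n + 1)) / real (fib N) = (1 - t) / 2"
    using fibN by (simp add: t_def field_simps)
  have H1: "?H 1 = 1 / 10 - 1 / real N / 10 + (1 + t) / 10"
  proof -
    have "?H 1 = (real N - 1) / (10 * real N) + real (fib (n + 2)) / (5 * real (fib N))"
      using resistance_kernel_of_nat [of 1 N] by (simp add: N)
    also have "real (fib (n + 2)) / (5 * real (fib N)) = (t + real (fib (n + 1)) / real (fib N)) / 5"
      using fibN by (simp add: t_def field_simps)
    also note t
    finally show ?thesis using assms by (simp add: field_simps)
  qed
  have H2: "?H 2 = 1 / 5 - 2 * (1 / real N) / 5 + (1 - t) / 10"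
  proof -
    have "?H 2 = 2 * (real N - 2) / (10 * real N) + real (fib (n + 1)) / real (fib N) / 5"
      using resistance_kernel_of_nat [of 2 N] by (simp add: N numeral_eq_Suc)
    then show ?thesis unfolding t using assms by (simp add: field_simps)
  qed
  have H3: "?H 3 = 3 / 10 - 9 * (1 / real N) / 10 + 2 * t / 5"
  proof -
    have "?H 3 = 3 * (real N - 3) / (10 * real N) + 2 * t / 5"
      using resistance_kernel_of_nat [of 3 N] by (simp add: N t_def numeral_eq_Suc)
    then show ?thesis using assms by (simp add: field_simps)
  qed
  have L0: "?L 0 = 1 / real N - 1"
    using even [of 1] even [of 2] H1 H2 by (simp add: diff_divide_distrib add_divide_distrib)
  have L1: "?L 1 = 1 / real N"
    using even [of 1] H1 H2 H3 by (simp add: diff_divide_distrib add_divide_distrib)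
  have interior: "?L (int j) = 1 / real N" if "2 \<le> j" "j + 2 \<le> N" for j
  proof -
    \<comment> \<open>With \<open>N = i + m + 4\<close> no truncated subtraction remains. The
      Fibonacci products, expanded in \<open>fib i\<close>, \<open>fib (i + 1)\<close>,
      \<open>fib m\<close>, \<open>fib (m + 1)\<close>, cancel; the quadratic part leaves
      \<open>2 * (1 + 4) * r\<close>.\<close>
    define i m where "i = j - 2" and "m = N - (j + 2)"
    with that have i: "j = i + 2" and m: "N = i + m + 4"
      by simp_all
    have shifts: "int (i + 2) + 1 = int (i + 3)" "int (i + 2) - 1 = int (i + 1)"
      "int (i + 2) + 2 = int (i + 4)" "int (i + 2) - 2 = int i"
      by simp_all
    have fibs: "fib (i + 2) = fib i + fib (i + 1)" "fib (i + 3) = fib i + 2 * fib (i + 1)"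
      "fib (i + 4) = 2 * fib i + 3 * fib (i + 1)" for i
      by (simp_all add: numeral_eq_Suc)
    define r s where "r = 1 / (10 * real N)" and "s = 1 / (5 * real (fib N))"
    have val: "?H (int k) = real k * real l * r + real (fib k) * real (fib l) * s"
      if "N = k + l" for k l
      using resistance_kernel_of_nat [of k N] that by (simp add: r_def s_def)
    have vals: "?H (int i) = real i * real (m + 4) * r + real (fib i) * real (fib (m + 4)) * s"
      "?H (int (i + 1)) =
        real (i + 1) * real (m + 3) * r + real (fib (i + 1)) * real (fib (m + 3)) * s"
      "?H (int (i + 2)) =
        real (i + 2) * real (m + 2) * r + real (fib (i + 2)) * real (fib (m + 2)) * s"
      "?H (int (i + 3)) =
        real (i + 3) * real (m + 1) * r + real (fib (i + 3)) * real (fib (m + 1)) * s"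
      "?H (int (i + 4)) = real (i + 4) * real m * r + real (fib (i + 4)) * real (fib m) * s"
      by (rule val, simp add: m)+
    have "?L (int j) = 10 * r"
      unfolding i by (simp only: shifts vals fibs) (simp add: algebra_simps)
    then show ?thesis by (simp add: r_def)
  qed
  have L_nat: "?L (int j) = 1 / real N - of_bool (j = 0)" if "j + 2 \<le> N" for j
    using that L0 L1 interior [of j] by (cases "j = 0 \<or> j = 1") auto
  define j where "j = nat (k mod int N)"
  have j: "int j = k mod int N" "j < N"
    using assms by (simp_all add: j_def nat_less_iff)
  have kj: "[k = int j] (mod int N)"
    by (simp add: j cong_def)
  have Lk: "?L k = ?L (int j)"
    by (simp only: resistance_kernel_cong [OF kj]
      resistance_kernel_cong [OF cong_add [OF kj cong_refl]]
      resistance_kernel_cong [OF cong_diff [OF kj cong_refl]])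
  have k0: "[k = 0] (mod int N) \<longleftrightarrow> j = 0"
    using j by (auto simp: cong_def)
  show ?thesis
  proof (cases "j + 2 \<le> N")
    case True
    then show ?thesis unfolding sum4 Lk k0 by (rule L_nat)
  next
    case False
    \<comment> \<open>Only \<open>j = N - 1\<close> is left, which is congruent to -1.\<close>
    with j assms have "int j = int N - 1" "j \<noteq> 0" by simp_all
    then have k1: "[- 1 = int j] (mod int N)"
      by (simp add: cong_iff_dvd_diff)
    have "?L (int j) = ?L (- 1)"
      by (simp only: resistance_kernel_cong [OF k1]
        resistance_kernel_cong [OF cong_add [OF k1 cong_refl]]
        resistance_kernel_cong [OF cong_diff [OF k1 cong_refl]])
    with even_L [of 1] L1 Lk k0 \<open>j \<noteq> 0\<close> show ?thesis
      unfolding sum4 by simp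
  qed
qed

section \<open>Potentials and effective resistances\<close>

text \<open>Two of the four shifts differ by at most 4, so \<open>N \<ge> 5\<close> keeps them
  distinct modulo \<open>N\<close> and no neighbour is counted twice.\<close>

lemma sum_cycle_square_neighbours:
  assumes "N \<ge> 5" "u \<in> {0..<int N}"
  shows "(\<Sum>w | (u, w) \<in> parcs (cycle_square N). f w) =
    (\<Sum>d\<in>{1, -1, 2, -2}. f ((u + d) mod int N))"
proof -
  let ?D = "{1, -1, 2, -2 :: int}"
  have inj: "inj_on (\<lambda>d. (u + d) mod int N) ?D"
  proof (rule inj_onI)
    fix d e assume de: "d \<in> ?D" "e \<in> ?D" and "(u + d) mod int N = (u + e) mod int N"
    then have "int N dvd d - e"
      by (simp add: mod_eq_dvd_iff)
    moreover have "\<bar>d - e\<bar> < int N"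
      using de assms by auto
    ultimately show "d = e"
      using dvd_imp_le_int [of "d - e" "int N"] by fastforce
  qed
  have neighbour_iff: "(\<exists>d\<in>?D. [u - w = d] (mod int N)) \<longleftrightarrow> (\<exists>d\<in>?D. w = (u + d) mod int N)"
    if "w \<in> {0..<int N}" for w
  proof -
    have "[u - w = d] (mod int N) \<longleftrightarrow> w = (u + - d) mod int N" for d
    proof -
      have "[u - w = d] (mod int N) \<longleftrightarrow> [w = u + - d] (mod int N)"
        by (simp add: cong_iff_dvd_diff dvd_diff_commute algebra_simps)
      with that show ?thesis by (simp add: cong_def)
    qed
    then show ?thesis by auto
  qed
  have "{w. (u, w) \<in> parcs (cycle_square N)} =
      {w \<in> {0..<int N}. \<exists>d\<in>?D. [u - w = d] (mod int N)}"
    using assms(2) unfolding cycle_square_def by simp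
  also have "\<dots> = {w \<in> {0..<int N}. \<exists>d\<in>?D. w = (u + d) mod int N}"
    by (intro Collect_cong conj_cong refl neighbour_iff)
  also have "\<dots> = (\<lambda>d. (u + d) mod int N) ` ?D"
    using assms by auto
  finally have "{w. (u, w) \<in> parcs (cycle_square N)} = (\<lambda>d. (u + d) mod int N) ` ?D" .
  then show ?thesis
    by (simp only: sum.reindex [OF inj] o_def)
qed

text \<open>The constants \<open>1 / N\<close> of the two Laplacians cancel, leaving the point
  masses at \<open>p\<close> and \<open>q\<close>.\<close>

lemma unit_current_potential_cycle_square:
  assumes "N \<ge> 5" "p \<in> {0..<int N}" "q \<in> {0..<int N}"
  shows "unit_current_potential (cycle_square N) p q
    (\<lambda>u. resistance_kernel N (u - q) - resistance_kernel N (u - p))"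
  unfolding unit_current_potential_def
proof
  let ?H = "resistance_kernel N" and ?D = "{1, -1, 2, -2 :: int}"
  fix u assume "u \<in> pverts (cycle_square N)"
  then have u: "u \<in> {0..<int N}" by (simp add: cycle_square_def)
  have shift: "?H ((u + d) mod int N - x) = ?H (u - x + d)" for d x
    by (rule resistance_kernel_cong) (simp add: cong_def mod_simps algebra_simps)
  have zero: "[u - x = 0] (mod int N) \<longleftrightarrow> u = x" if "x \<in> {0..<int N}" for x
    using that u mod_eq_dvd_iff [of u "int N" x] by (simp add: cong_0_iff)
  have lap: "(\<Sum>d\<in>?D. ?H (u - x) - ?H (u - x + d)) = 1 / real N - of_bool (u = x)"
    if "x \<in> {0..<int N}" for x
    using resistance_kernel_laplacian [of N "u - x"] assms(1) zero [OF that] by simp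
  have "(\<Sum>w | (u, w) \<in> parcs (cycle_square N). ?H (u - q) - ?H (u - p) - (?H (w - q) - ?H (w - p))) =
      (\<Sum>d\<in>?D. ?H (u - q) - ?H (u - q + d)) - (\<Sum>d\<in>?D. ?H (u - p) - ?H (u - p + d))"
    unfolding sum_cycle_square_neighbours [OF assms(1) u] shift sum_subtractf [symmetric]
    by (intro sum.cong) simp_all
  then show "(\<Sum>w | (u, w) \<in> parcs (cycle_square N).
      ?H (u - q) - ?H (u - p) - (?H (w - q) - ?H (w - p))) = of_bool (u = p) - of_bool (u = q)"
    unfolding lap [OF assms(2)] lap [OF assms(3)] by simp
qed

text \<open>Keeping two terms lets an unordered pair split into its two orderings later.\<close>

lemma effective_resistance_cycle_square:
  assumes "N \<ge> 5" "p \<in> {0..<int N}" "q \<in> {0..<int N}"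
  shows "effective_resistance (cycle_square N) p q =
    resistance_kernel N (p - q) + resistance_kernel N (q - p)"
proof -
  interpret pair_graph "cycle_square N"
    by (rule pair_graph_cycle_square [OF assms(1)])
  have "p \<in> pverts (cycle_square N)" "q \<in> pverts (cycle_square N)"
    using assms by (simp_all add: cycle_square_def)
  from effective_resistance_eqI [OF this unit_current_potential_cycle_square [OF assms]]
  show ?thesis by simp
qed

section \<open>Reduction to a single sum over the kernel\<close>

lemma sum_mod_translate:
  fixes f :: "int \<Rightarrow> 'a::comm_monoid_add"
  shows "(\<Sum>k\<in>{0..<int N}. f ((k + c) mod int N)) = (\<Sum>k\<in>{0..<int N}. f k)"
proof -
  let ?t = "\<lambda>k. (k + c) mod int N"
  have inj: "inj_on ?t {0..<int N}"
    by (rule inj_onI) (auto simp flip: cong_def simp: cong_add_rcancel intro: cong_less_imp_eq_int)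
  moreover have "?t ` {0..<int N} \<subseteq> {0..<int N}"
    by auto
  ultimately have "?t ` {0..<int N} = {0..<int N}"
    by (intro endo_inj_surj) simp_all
  then show ?thesis
    using sum.reindex [OF inj, of f] by (simp add: o_def)
qed

text \<open>
  Each unordered pair contributes \<open>h (p - q) + h (q - p)\<close>, so the Kirchhoff index is the sum of
  \<open>h (p - q)\<close> over all ordered pairs, the diagonal contributing nothing.
\<close>

lemma kirchhoff_index_cycle_square:
  assumes "N \<ge> 5"
  shows "kirchhoff_index (cycle_square N) = real N * (\<Sum>j\<le>N. resistance_kernel N (int j))"
proof -
  let ?H = "resistance_kernel N" and ?V = "{0..<int N}"
  let ?U = "{(p, q). p \<in> ?V \<and> q \<in> ?V \<and> p < q}" and ?W = "{(p, q). p \<in> ?V \<and> q \<in> ?V \<and> q < p}"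
  have V: "pverts (cycle_square N) = ?V"
    by (simp add: cycle_square_def)
  have fin: "finite ?U" "finite ?W"
    by (rule finite_subset [of _ "?V \<times> ?V"], auto)+
  have "kirchhoff_index (cycle_square N) = (\<Sum>(p, q)\<in>?U. ?H (p - q) + ?H (q - p))"
    unfolding kirchhoff_index_def V using assms
    by (intro sum.cong) (auto simp: effective_resistance_cycle_square)
  also have "\<dots> = (\<Sum>(p, q)\<in>?U. ?H (p - q)) + (\<Sum>(p, q)\<in>?U. ?H (q - p))"
    by (simp add: sum.distrib case_prod_unfold)
  also have "(\<Sum>(p, q)\<in>?U. ?H (q - p)) = (\<Sum>(p, q)\<in>?W. ?H (p - q))"
    by (rule sum.reindex_bij_witness [of _ prod.swap prod.swap]) auto
  also have "(\<Sum>(p, q)\<in>?U. ?H (p - q)) + (\<Sum>(p, q)\<in>?W. ?H (p - q)) =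
      (\<Sum>(p, q)\<in>?U \<union> ?W. ?H (p - q))"
    using fin by (intro sum.union_disjoint [symmetric]) auto
  also have "\<dots> = (\<Sum>(p, q)\<in>?V \<times> ?V. ?H (p - q))"
  proof (rule sum.mono_neutral_left)
    show "\<forall>x\<in>?V \<times> ?V - (?U \<union> ?W). (case x of (p, q) \<Rightarrow> ?H (p - q)) = 0"
    proof
      fix x assume x: "x \<in> ?V \<times> ?V - (?U \<union> ?W)"
      obtain p q where pq: "x = (p, q)" by (cases x)
      with x have "p = q" by auto
      with pq show "(case x of (p, q) \<Rightarrow> ?H (p - q)) = 0" by simp
    qed
  qed auto
  also have "\<dots> = (\<Sum>q\<in>?V. \<Sum>p\<in>?V. ?H (p - q))"
    unfolding sum.cartesian_product [symmetric] by (rule sum.swap)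
  also have "\<dots> = (\<Sum>q\<in>?V. \<Sum>p\<in>?V. ?H ((p + - q) mod int N))"
    by (intro sum.cong refl resistance_kernel_cong) (simp add: cong_def)
  also have "\<dots> = real N * (\<Sum>k\<in>?V. ?H k)"
    unfolding sum_mod_translate by simp
  also have "(\<Sum>k\<in>?V. ?H k) = (\<Sum>j<N. ?H (int j))"
    by (rule sum.reindex_bij_witness [of _ int nat]) auto
  \<comment> \<open>The added term at \<open>j = N\<close> is 0; the closed range matches the
    Fibonacci convolution.\<close>
  also have "\<dots> = (\<Sum>j\<le>N. ?H (int j))"
    using resistance_kernel_of_nat [of N N] by (simp add: lessThan_Suc_atMost [symmetric])
  finally show ?thesis .
qed

section \<open>Closed forms of the sums\<close>

text \<open>The convolution satisfies the Fibonacci recurrence with an extra term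
  \<open>fib (n + 2)\<close>.\<close>

lemma sum_fib_convolution:
  "5 * (\<Sum>k\<le>Suc n. fib k * fib (Suc n - k)) = n * fib (Suc n) + 2 * Suc n * fib n"
proof (induction n rule: fib.induct)
  case (3 n)
  let ?C = "\<lambda>n. \<Sum>k\<le>n. fib k * fib (n - k)"
  \<comment> \<open>The top two terms are split off, as the recurrence for
    \<open>fib (n + 3 - k)\<close> needs \<open>k \<le> n + 1\<close>; the last one vanishes by
    \<open>fib 0 = 0\<close>.\<close>
  have "?C (n + 3) = (\<Sum>k\<le>Suc n. fib k * fib (n + 3 - k)) + fib (n + 2)"
    by (simp add: numeral_eq_Suc)
  also have "(\<Sum>k\<le>Suc n. fib k * fib (n + 3 - k)) =
      (\<Sum>k\<le>Suc n. fib k * fib (n + 2 - k) + fib k * fib (Suc n - k))"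
  proof (intro sum.cong refl)
    fix k assume "k \<in> {..Suc n}"
    then have "n + 3 - k = Suc (Suc (Suc n - k))" "n + 2 - k = Suc (Suc n - k)"
      by auto
    then show "fib k * fib (n + 3 - k) = fib k * fib (n + 2 - k) + fib k * fib (Suc n - k)"
      by (simp add: algebra_simps)
  qed
  also have "\<dots> = ?C (n + 2) + ?C (Suc n)"
    by (simp add: sum.distrib numeral_eq_Suc)
  finally have "5 * ?C (n + 3) = 5 * ?C (Suc (Suc n)) + 5 * ?C (Suc n) + 5 * fib (n + 2)"
    by simp
  then show ?case
    unfolding 3 by (simp add: numeral_eq_Suc algebra_simps)
qed simp_all

text \<open>A parameter \<open>c\<close> separate from \<open>n\<close> keeps the summand fixed
  during induction.\<close>

lemma sum_times_diff: "(\<Sum>k\<le>n. real k * (c - real k)) =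
    real n * (real n + 1) * (3 * c - 2 * real n - 1) / 6"
  by (induction n) (simp_all add: field_simps)

theorem theorem4p2:
  fixes N :: nat
  assumes "N \<ge> 5"
  shows "kirchhoff_index (cycle_square N) =
    real N * (real N - 1) * (5 * real N + 17) / 300
      + 2 * (real N)\<^sup>2 / 25 * (real (fib (N - 1)) / real (fib N))"
proof -
  have fibN: "real (fib N) > 0"
    using assms by (simp add: fib_neq_0_nat)
  have "real (5 * (\<Sum>k\<le>N. fib k * fib (N - k))) = real ((N - 1) * fib N + 2 * N * fib (N - 1))"
    using sum_fib_convolution [of "N - 1"] assms by simp
  then have conv: "(\<Sum>k\<le>N. real (fib k) * real (fib (N - k))) =
      ((real N - 1) * real (fib N) + 2 * real N * real (fib (N - 1))) / 5"
    using assms by (simp add: of_nat_diff)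
  have "(\<Sum>j\<le>N. resistance_kernel N (int j)) =
      (\<Sum>k\<le>N. real k * (real N - real k)) / (10 * real N)
        + (\<Sum>k\<le>N. real (fib k) * real (fib (N - k))) / (5 * real (fib N))"
    by (simp add: resistance_kernel_of_nat sum.distrib sum_divide_distrib)
  \<comment> \<open>The quadratic part gives \<open>N (N - 1) (N + 1) / 60\<close>, the convolution
    \<open>N (N - 1) / 25\<close> and the Fibonacci quotient; hence
    \<open>5 (N + 1) + 12 = 5 N + 17\<close>.\<close>
  then show ?thesis
    unfolding kirchhoff_index_cycle_square [OF assms] sum_times_diff conv
    using fibN assms by (simp add: field_simps power2_eq_square)
qed

end
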